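(* For any $w\in S_n$ and any climbing chain $C$ of $w$, $$\overline{\mathrm{raj}}(w)\le \#M(C).$$
   Context: Conventions. Permutations are in one-line notation; $t_{ij}$ is the transposition of $i,j$, and $wt_{ij}$ is $w$ with the values in positions $i$ and $j$ exchanged. $w_0\in S_n$ is the longest permutation, $w_0(k)=n+1-k$. The Bruhat order is the transitive closure of $w\le wt_{ij}$ for $i<j$ with $w(i)<w(j)$; $\lessdot$ denotes its cover relation. $[n]=\{1,\ldots,n\}$. Climbing chains. A climbing chain of $w\in S_n$ is a sequence $C=(C_1,\ldots,C_m)$ of pairs (links) $C_p=(i_p,j_p)$ with $i_p<j_p$, $i_1\le\cdots\le i_m$, $wt_{i_1j_1}\cdots t_{i_mj_m}=w_0$, and $wt_{i_1j_1}\cdots t_{i_{p-1}j_{p-1}}\lessdot wt_{i_1j_1}\cdots t_{i_pj_p}$ for each $p\in[m]$. (The only climbing chain of $w_0$ is empty.) The set of minimal markings is $M(C)=\{C_p\mid i_{p-1}<i_p,\text{ or } i_{p-1}=i_p\text{ and }j_{p-1}<j_p\}$ with $i_0=0$. Codes. $\overline{\mathrm{rajcode}}(w)_i$ is the maximal number $r$ of positions in a sequence $i=\alpha_1<\cdots<\alpha_r\le n$ with $w(\alpha_1)<\cdots<w(\alpha_r)$, minus one, and $\overline{\mathrm{raj}}(w)=\sum_{i=1}^n\overline{\mathrm{rajcode}}(w)_i$. *)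

theory Defs
  imports "HOL-Combinatorics.Permutations"
begin

text \<open>
  An element of $S_n$ is a function \<open>w :: nat \<Rightarrow> nat\<close> with \<open>w permutes {1..n}\<close>; it is the identity
  outside \<open>{1..n}\<close>. The product $w t_{ij}$ is \<open>w \<circ> transpose i j\<close>, which exchanges the values of
  \<open>w\<close> in positions \<open>i\<close> and \<open>j\<close>.
\<close>

definition longest_perm :: "nat \<Rightarrow> nat \<Rightarrow> nat" where
  "longest_perm n = (\<lambda>k. if k \<in> {1..n} then n + 1 - k else k)"

definition bruhat_step :: "nat \<Rightarrow> (nat \<Rightarrow> nat) \<Rightarrow> (nat \<Rightarrow> nat) \<Rightarrow> bool" where
  "bruhat_step n u v \<longleftrightarrow> u permutes {1..n} \<and>
     (\<exists>i\<in>{1..n}. \<exists>j\<in>{1..n}. i < j \<and> u i < u j \<and> v = u \<circ> transpose i j)"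

definition bruhat_le :: "nat \<Rightarrow> (nat \<Rightarrow> nat) \<Rightarrow> (nat \<Rightarrow> nat) \<Rightarrow> bool" where
  "bruhat_le n = (bruhat_step n)\<^sup>*\<^sup>*"

definition bruhat_less :: "nat \<Rightarrow> (nat \<Rightarrow> nat) \<Rightarrow> (nat \<Rightarrow> nat) \<Rightarrow> bool" where
  "bruhat_less n u v \<longleftrightarrow> bruhat_le n u v \<and> u \<noteq> v"

definition bruhat_covers :: "nat \<Rightarrow> (nat \<Rightarrow> nat) \<Rightarrow> (nat \<Rightarrow> nat) \<Rightarrow> bool" where
  "bruhat_covers n u v \<longleftrightarrow> u permutes {1..n} \<and> v permutes {1..n} \<and> bruhat_less n u v \<and>
     \<not> (\<exists>z. z permutes {1..n} \<and> bruhat_less n u z \<and> bruhat_less n z v)"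

definition apply_links :: "(nat \<Rightarrow> nat) \<Rightarrow> (nat \<times> nat) list \<Rightarrow> nat \<Rightarrow> nat" where
  "apply_links w C = foldl (\<lambda>u (i, j). u \<circ> transpose i j) w C"

definition climbing_chain :: "nat \<Rightarrow> (nat \<Rightarrow> nat) \<Rightarrow> (nat \<times> nat) list \<Rightarrow> bool" where
  "climbing_chain n w C \<longleftrightarrow>
     (\<forall>(i, j)\<in>set C. i \<in> {1..n} \<and> j \<in> {1..n} \<and> i < j) \<and>
     sorted (map fst C) \<and>
     apply_links w C = longest_perm n \<and>
     (\<forall>p<length C. bruhat_covers n (apply_links w (take p C)) (apply_links w (take (Suc p) C)))"

text \<open>
  List indices start at 0, so \<open>C ! 0\<close> is the first link. It is always marked, since $i_0 = 0 < i_1$.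
\<close>

definition minimal_markings :: "(nat \<times> nat) list \<Rightarrow> (nat \<times> nat) set" where
  "minimal_markings C = {C ! p | p. p < length C \<and>
     (p = 0 \<or> fst (C ! (p - 1)) < fst (C ! p) \<or>
      fst (C ! (p - 1)) = fst (C ! p) \<and> snd (C ! (p - 1)) < snd (C ! p))}"

definition increasing_from :: "nat \<Rightarrow> (nat \<Rightarrow> nat) \<Rightarrow> nat \<Rightarrow> nat list \<Rightarrow> bool" where
  "increasing_from n w i \<alpha> \<longleftrightarrow> \<alpha> \<noteq> [] \<and> hd \<alpha> = i \<and> set \<alpha> \<subseteq> {1..n} \<and>
     sorted_wrt (<) \<alpha> \<and> sorted_wrt (<) (map w \<alpha>)"

text \<open>
  For \<open>i \<in> {1..n}\<close> the set below is finite and contains 1, because of the sequence \<open>[i]\<close>.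
\<close>

definition rajcode_bar :: "nat \<Rightarrow> (nat \<Rightarrow> nat) \<Rightarrow> nat \<Rightarrow> nat" where
  "rajcode_bar n w i = Max {length \<alpha> | \<alpha>. increasing_from n w i \<alpha>} - 1"

definition raj_bar :: "nat \<Rightarrow> (nat \<Rightarrow> nat) \<Rightarrow> nat" where
  "raj_bar n w = (\<Sum>i = 1..n. rajcode_bar n w i)"

end

theory Submission
  imports Defs
begin

text \<open>
  Write $e_u(a)$ for the code of $u$ at position $a$, and $E_u(j, v)$ for the maximal number of
  positions beyond $j$ carrying increasing values above $v$, so that $e_u(a) = E_u(a, u(a))$.
  Besides $S(u) = \sum_a e_u(a)$ consider, after a link $(i,j)$, the quantity $T_{ij}(u)$ in which the
  summand $e_u(i)$ is lowered to $E_u(j, u(i))$. Let $u'$ be obtained from $u$ by the link $(i,j)$ of a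
  climbing chain. Then $S(u) \le \max(S(u'), T_{ij}(u') + 1)$, as one sees from the second
  entry of a longest increasing sequence starting at position $i$, and $T_{ij'}(u) \le T_{ij}(u')$ for
  $j \le j'$. So a run of links with equal first and decreasing second components, of which only
  the first is marked, lowers the potential by at most one.
\<close>

section \<open>Longest increasing sequences beyond a position and above a value\<close>

definition incr_above :: "nat \<Rightarrow> (nat \<Rightarrow> nat) \<Rightarrow> nat \<Rightarrow> nat \<Rightarrow> nat list \<Rightarrow> bool" where
  "incr_above n u p v \<alpha> \<longleftrightarrow> set \<alpha> \<subseteq> {p<..n} \<and> sorted_wrt (<) \<alpha> \<and> sorted_wrt (<) (map u \<alpha>) \<and>
     (\<forall>x\<in>set \<alpha>. v < u x)"

definition max_above :: "nat \<Rightarrow> (nat \<Rightarrow> nat) \<Rightarrow> nat \<Rightarrow> nat \<Rightarrow> nat" where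
  "max_above n u p v = Max (length ` {\<alpha>. incr_above n u p v \<alpha>})"

lemma finite_incr_above: "finite {\<alpha>. incr_above n u p v \<alpha>}"
  by (rule finite_subset[OF _ finite_subset_distinct[of "{p<..n}"]])
    (auto simp: incr_above_def strict_sorted_iff)

lemma incr_above_Nil: "incr_above n u p v []"
  by (simp add: incr_above_def)

lemma incr_above_Cons:
  "incr_above n u p v (k # \<alpha>) \<longleftrightarrow> p < k \<and> k \<le> n \<and> v < u k \<and> incr_above n u k (u k) \<alpha>"
  by (fastforce simp: incr_above_def)

lemma length_le_max_above: "incr_above n u p v \<alpha> \<Longrightarrow> length \<alpha> \<le> max_above n u p v"
  unfolding max_above_def by (intro Max_ge finite_imageI finite_incr_above) auto

lemma max_above_attained: "\<exists>\<alpha>. incr_above n u p v \<alpha> \<and> length \<alpha> = max_above n u p v"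
proof -
  have "max_above n u p v \<in> length ` {\<alpha>. incr_above n u p v \<alpha>}"
    unfolding max_above_def using incr_above_Nil[of n u p v]
    by (intro Max_in finite_imageI finite_incr_above) auto
  then show ?thesis by auto
qed

lemma max_above_Suc_le:
  assumes "p < k" "k \<le> n" "v < u k"
  shows "Suc (max_above n u k (u k)) \<le> max_above n u p v"
proof -
  obtain \<alpha> where "incr_above n u k (u k) \<alpha>" "length \<alpha> = max_above n u k (u k)"
    using max_above_attained by blast
  with assms show ?thesis using length_le_max_above[of n u p v "k # \<alpha>"]
    by (simp add: incr_above_Cons)
qed

text \<open>Splitting off the first entry \<open>k\<close> of an optimal sequence leaves an optimal
  sequence for the code at \<open>k\<close>. With \<open>max_above_Suc_le\<close>, this recursion
  replaces explicit lists in most later arguments.\<close>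

lemma max_above_cases:
  obtains "max_above n u p v = 0"
  | k where "p < k" "k \<le> n" "v < u k" "max_above n u p v = Suc (max_above n u k (u k))"
proof -
  obtain \<alpha> where \<alpha>: "incr_above n u p v \<alpha>" "length \<alpha> = max_above n u p v"
    using max_above_attained by blast
  show thesis
  proof (cases \<alpha>)
    case Nil
    with \<alpha> that(1) show thesis by simp
  next
    case (Cons k \<beta>)
    with \<alpha> have k: "p < k" "k \<le> n" "v < u k" "incr_above n u k (u k) \<beta>"
      by (auto simp: incr_above_Cons)
    have "max_above n u p v \<le> Suc (max_above n u k (u k))"
      using \<alpha>(2) Cons length_le_max_above[OF k(4)] by simp
    with max_above_Suc_le[of p k n v u] k that(2) show thesis by simp
  qed
qed

lemma max_above_mono: "p \<le> p' \<Longrightarrow> v \<le> v' \<Longrightarrow> max_above n u p' v' \<le> max_above n u p v"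
  by (rule max_above_cases[of n u p' v']) (auto intro!: max_above_Suc_le)

lemma max_above_cong:
  assumes "\<And>x. p < x \<Longrightarrow> u x = u' x"
  shows "max_above n u p v = max_above n u' p v"
proof -
  have "incr_above n u p v \<alpha> = incr_above n u' p v \<alpha>" for \<alpha>
  proof (cases "set \<alpha> \<subseteq> {p<..n}")
    case True
    then have "\<forall>x\<in>set \<alpha>. u x = u' x" using assms by auto
    then show ?thesis by (simp add: incr_above_def cong: map_cong)
  qed (simp add: incr_above_def)
  then have "incr_above n u p v = incr_above n u' p v" by (rule ext)
  then show ?thesis by (simp add: max_above_def)
qed

text \<open>Prepending \<open>i\<close> lengthens every sequence by one, which the subtraction in
  \<open>rajcode_bar\<close> cancels.\<close>

lemma rajcode_bar_eq_max_above:
  assumes "i \<in> {1..n}"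
  shows "rajcode_bar n u i = max_above n u i (u i)"
proof -
  have "increasing_from n u i \<alpha> \<longleftrightarrow> (\<exists>\<beta>. \<alpha> = i # \<beta> \<and> incr_above n u i (u i) \<beta>)" for \<alpha>
    using assms by (cases \<alpha>) (fastforce simp: increasing_from_def incr_above_def)+
  then have "{length \<alpha> | \<alpha>. increasing_from n u i \<alpha>} =
      Suc ` length ` {\<beta>. incr_above n u i (u i) \<beta>}"
    by force
  moreover have "Max (Suc ` length ` {\<beta>. incr_above n u i (u i) \<beta>}) = Suc (max_above n u i (u i))"
    unfolding max_above_def using incr_above_Nil[of n u i "u i"]
    by (intro mono_Max_commute[symmetric] finite_imageI finite_incr_above) (auto intro: monoI)
  ultimately show ?thesis by (simp add: rajcode_bar_def)
qed

lemma raj_bar_eq_sum: "raj_bar n u = (\<Sum>a = 1..n. max_above n u a (u a))"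
  unfolding raj_bar_def by (intro sum.cong refl rajcode_bar_eq_max_above)

section \<open>Bruhat covers given by transpositions\<close>

lemma bruhat_step_weight:
  assumes "bruhat_step n u v"
  shows "(\<Sum>k = 1..n. k * v k) < (\<Sum>k = 1..n. k * u k)"
proof -
  obtain i j where ij: "i \<in> {1..n}" "j \<in> {1..n}" "i < j" "u i < u j" "v = u \<circ> transpose i j"
    using assms by (auto simp: bruhat_step_def)
  have split: "(\<Sum>k = 1..n. k * f k) = i * f i + j * f j + (\<Sum>k\<in>{1..n} - {i} - {j}. k * f k)"
    for f :: "nat \<Rightarrow> nat"
    using ij sum.remove[of "{1..n}" i "\<lambda>k. k * f k"]
      sum.remove[of "{1..n} - {i}" j "\<lambda>k. k * f k"] by simp
  have rest: "(\<Sum>k\<in>{1..n} - {i} - {j}. k * v k) = (\<Sum>k\<in>{1..n} - {i} - {j}. k * u k)"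
    using ij by (intro sum.cong) auto
  \<comment> \<open>In these terms the two sides differ by \<open>Suc d * Suc e\<close>, as in the
    rearrangement inequality.\<close>
  obtain d e where "j = i + Suc d" "u j = u i + Suc e"
    using ij(3,4) by (metis less_imp_Suc_add add_Suc_right)
  then have "i * u j + j * u i < i * u i + j * u j"
    by (simp add: algebra_simps)
  with ij show ?thesis unfolding split[of v] split[of u] rest by simp
qed

lemma bruhat_le_weight:
  assumes "bruhat_le n u v"
  shows "u = v \<or> (\<Sum>k = 1..n. k * v k) < (\<Sum>k = 1..n. k * u k)"
  using assms unfolding bruhat_le_def
  by (induction rule: rtranclp_induct) (auto dest: bruhat_step_weight)

text \<open>The sum of \<open>k * u k\<close> drops strictly in each Bruhat step, so it serves as a
  rank function in place of the inversion number.\<close>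

lemma bruhat_le_antisym: "bruhat_le n u v \<Longrightarrow> bruhat_le n v u \<Longrightarrow> u = v"
  using bruhat_le_weight[of n u v] bruhat_le_weight[of n v u] by auto

lemma bruhat_step_swap:
  assumes "u permutes {1..n}" "i \<in> {1..n}" "j \<in> {1..n}" "i < j" "u i < u j"
  shows "bruhat_step n u (u \<circ> transpose i j)"
  using assms unfolding bruhat_step_def by blast

lemma permutes_swap:
  "u permutes S \<Longrightarrow> i \<in> S \<Longrightarrow> j \<in> S \<Longrightarrow> u \<circ> transpose i j permutes S"
  by (intro permutes_compose permutes_swap_id)

text \<open>Otherwise swapping back would be a step upwards, against antisymmetry.\<close>

lemma cover_swap_less:
  assumes cov: "bruhat_covers n u (u \<circ> transpose i j)"
    and ij: "i \<in> {1..n}" "j \<in> {1..n}" "i < j"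
  shows "u i < u j"
proof (rule ccontr)
  assume "\<not> u i < u j"
  have u: "u permutes {1..n}" and v: "u \<circ> transpose i j permutes {1..n}"
    and less: "bruhat_less n u (u \<circ> transpose i j)"
    using cov by (auto simp: bruhat_covers_def)
  have "u i \<noteq> u j" using ij permutes_inj[OF u] by (auto dest: injD)
  with \<open>\<not> u i < u j\<close> have "bruhat_step n (u \<circ> transpose i j) ((u \<circ> transpose i j) \<circ> transpose i j)"
    by (intro bruhat_step_swap v ij) auto
  then have "bruhat_le n (u \<circ> transpose i j) u"
    by (auto simp: bruhat_le_def comp_assoc)
  with less show False using bruhat_le_antisym by (auto simp: bruhat_less_def)
qed

lemma cover_swap_gap:
  assumes cov: "bruhat_covers n u (u \<circ> transpose i j)"
    and ij: "i \<in> {1..n}" "j \<in> {1..n}" and k: "i < k" "k < j"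
  shows "u k < u i \<or> u j < u k"
proof (rule ccontr)
  assume "\<not> (u k < u i \<or> u j < u k)"
  have u: "u permutes {1..n}" using cov by (auto simp: bruhat_covers_def)
  have "u k \<noteq> u i" "u k \<noteq> u j" using k permutes_inj[OF u] by (auto dest: injD)
  with \<open>\<not> (u k < u i \<or> u j < u k)\<close> have val: "u i < u k" "u k < u j" by auto
  have kn: "k \<in> {1..n}" using ij k by auto
  \<comment> \<open>If \<open>u\<close> has values a < b < c at \<open>i\<close>, \<open>k\<close>,
    \<open>j\<close>, then \<open>u\<close>, \<open>z\<close>, \<open>y\<close> and the target read
    abc, bac, cab, cba there. Each swap exchanges an ascent, so \<open>z\<close> lies strictly
    between the ends of the cover.\<close>
  define z where "z = u \<circ> transpose i k"
  define y where "y = z \<circ> transpose i j"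
  have z: "z permutes {1..n}" and y: "y permutes {1..n}"
    unfolding z_def y_def by (intro permutes_swap u ij kn)+
  have v: "u \<circ> transpose i j = y \<circ> transpose k j"
    using k by (auto simp: y_def z_def fun_eq_iff transpose_def)
  have uz: "bruhat_step n u z"
    unfolding z_def by (intro bruhat_step_swap u ij kn k val)
  have zy: "bruhat_step n z y"
    unfolding y_def using k val by (intro bruhat_step_swap z ij) (auto simp: z_def)
  have yv: "bruhat_step n y (u \<circ> transpose i j)"
    unfolding v using k val
    by (intro bruhat_step_swap y ij kn) (auto simp: y_def z_def transpose_def)
  have "bruhat_le n u z" "bruhat_le n z (u \<circ> transpose i j)"
    using uz zy yv by (auto simp: bruhat_le_def)
  moreover have "u \<noteq> z" using k val by (auto simp: z_def fun_eq_iff intro!: exI[of _ k])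
  moreover have "z k \<noteq> (u \<circ> transpose i j) k" using k val by (auto simp: z_def)
  then have "z \<noteq> u \<circ> transpose i j" by auto
  ultimately show False using cov z by (auto simp: bruhat_covers_def bruhat_less_def)
qed

section \<open>The potential $T_{ij}(u)$ and the effect of a single link\<close>

definition run_potential :: "nat \<Rightarrow> (nat \<Rightarrow> nat) \<Rightarrow> nat \<Rightarrow> nat \<Rightarrow> nat" where
  "run_potential n u i j = (\<Sum>a\<in>{1..n} - {i}. max_above n u a (u a)) + max_above n u j (u i)"

lemma run_potential_le_raj_bar:
  assumes "i \<in> {1..n}" "i \<le> j"
  shows "run_potential n u i j \<le> raj_bar n u"
  using assms max_above_mono[of i j "u i" "u i" n u]
    sum.remove[of "{1..n}" i "\<lambda>a. max_above n u a (u a)"]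
  by (simp add: run_potential_def raj_bar_eq_sum)

text \<open>Assumption \<open>top\<close> reflects the sorted first components of a chain: positions
  before \<open>i\<close> are never moved again, so they already hold the largest values.\<close>

locale covering_link =
  fixes n i j :: nat and u u' :: "nat \<Rightarrow> nat"
  assumes i: "i \<in> {1..n}" and j: "j \<in> {1..n}" and ij: "i < j"
    and u'_def: "u' = u \<circ> transpose i j"
    and cover: "bruhat_covers n u u'"
    and top: "\<And>a. a \<in> {1..n} \<Longrightarrow> a < i \<Longrightarrow> max_above n u a (u a) = 0"
begin

lemma value_less: "u i < u j"
  using cover_swap_less cover i j ij unfolding u'_def by blast

lemma gap: "i < k \<Longrightarrow> k < j \<Longrightarrow> u k < u i \<or> u j < u k"
  using cover_swap_gap cover i j unfolding u'_def by blast

lemma u'_simps: "u' i = u j" "u' j = u i" "k \<noteq> i \<Longrightarrow> k \<noteq> j \<Longrightarrow> u' k = u k"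
  by (auto simp: u'_def)

lemma max_above_u': "max_above n u' j v = max_above n u j v"
  using ij by (intro max_above_cong) (auto simp: u'_simps)

text \<open>To the right of \<open>i\<close> the link only lowers the value at \<open>j\<close>,
  from \<open>u j\<close> to \<open>u i\<close>. An ascent starting at \<open>j\<close> clearly
  survives, and one ending at \<open>j\<close> survives because \<open>gap\<close> puts its lower
  value below \<open>u i\<close>. Induction from the right turns this into a bound on codes.\<close>

lemma max_above_le_after:
  assumes "i < a"
  shows "max_above n u a (u a) \<le> max_above n u' a (u' a)"
  using assms
proof (induction "n - a" arbitrary: a rule: less_induct)
  case less
  show ?case
  proof (rule max_above_cases[of n u a "u a"])
    fix k assume k: "a < k" "k \<le> n" "u a < u k"
      "max_above n u a (u a) = Suc (max_above n u k (u k))"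
    have "u' a < u' k"
    proof (cases "k = j")
      case True
      with k less.prems gap[of a] show ?thesis by (auto simp: u'_simps)
    next
      case False
      with k less.prems value_less show ?thesis by (cases "a = j") (auto simp: u'_simps)
    qed
    with k have "Suc (max_above n u' k (u' k)) \<le> max_above n u' a (u' a)"
      by (intro max_above_Suc_le) auto
    moreover have "max_above n u k (u k) \<le> max_above n u' k (u' k)"
      using k less.prems by (intro less.hyps) auto
    ultimately show ?thesis using k by linarith
  qed simp
qed

lemma max_above_le:
  assumes "a \<in> {1..n}" "a \<noteq> i"
  shows "max_above n u a (u a) \<le> max_above n u' a (u' a)"
  using assms top[of a] max_above_le_after[of a] by (cases "a < i") auto

lemma sum_others_le:
  "(\<Sum>a\<in>{1..n} - {i} - {j}. max_above n u a (u a)) \<le>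
   (\<Sum>a\<in>{1..n} - {i} - {j}. max_above n u' a (u' a))"
  by (intro sum_mono max_above_le) auto

lemma run_potential_split:
  "run_potential n v i q = (\<Sum>a\<in>{1..n} - {i} - {j}. max_above n v a (v a)) +
     max_above n v j (v j) + max_above n v q (v i)"
  using j ij sum.remove[of "{1..n} - {i}" j "\<lambda>a. max_above n v a (v a)"]
  by (simp add: run_potential_def)

lemma raj_bar_split:
  "raj_bar n v = (\<Sum>a\<in>{1..n} - {i} - {j}. max_above n v a (v a)) +
     max_above n v j (v j) + max_above n v i (v i)"
  using i sum.remove[of "{1..n}" i "\<lambda>a. max_above n v a (v a)"] run_potential_split[of v i]
  by (simp add: run_potential_def raj_bar_eq_sum)

text \<open>Nothing beyond \<open>j\<close> changes, so the link merely exchanges two summands: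
  $E_u(j, u(i))$ becomes that of position \<open>j\<close> and $E_u(j, u(j))$ that of position
  \<open>i\<close>.\<close>

lemma run_potential_step: "j \<le> q \<Longrightarrow> run_potential n u i q \<le> run_potential n u' i j"
  using sum_others_le max_above_mono[of j q "u i" "u i" n u]
  by (simp add: run_potential_split u'_simps max_above_u')

lemma raj_bar_step: "raj_bar n u \<le> raj_bar n u' \<or> raj_bar n u \<le> Suc (run_potential n u' i j)"
proof (rule max_above_cases[of n u i "u i"])
  assume "max_above n u i (u i) = 0"
  then show ?thesis using sum_others_le max_above_le[OF j] ij
    by (simp add: raj_bar_split)
next
  fix k assume k: "i < k" "k \<le> n" "u i < u k"
    "max_above n u i (u i) = Suc (max_above n u k (u k))"
  consider "k = j" | "u j < u k" | "k \<noteq> j" "u k \<le> u j" by linarith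
  then show ?thesis
  proof cases
    \<comment> \<open>The sequence passes through \<open>j\<close>; losing the entry
      \<open>j\<close> costs the one unit in \<open>Suc\<close>.\<close>
    case 1
    then show ?thesis using k sum_others_le max_above_le[OF j] ij
      by (simp add: raj_bar_split run_potential_split u'_simps max_above_u')
  next
    \<comment> \<open>The tail from \<open>k\<close> still continues position \<open>i\<close> after
      its value has risen to \<open>u j\<close>.\<close>
    case 2
    then have "u' k = u k" using k by (intro u'_simps) auto
    then have "Suc (max_above n u' k (u' k)) \<le> max_above n u' i (u' i)"
      using k 2 by (intro max_above_Suc_le) (auto simp: u'_simps)
    then have "max_above n u i (u i) \<le> max_above n u' i (u' i)"
      using k max_above_le_after[of k] by simp
    then show ?thesis using sum_others_le max_above_le[OF j] ij
      by (simp add: raj_bar_split)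
  next
    \<comment> \<open>By \<open>gap\<close> the sequence jumps beyond \<open>j\<close>, so it is
      counted by the new summand of position \<open>j\<close>.\<close>
    case 3
    then have "j < k" using k gap[of k] by force
    then have "max_above n u i (u i) \<le> max_above n u j (u i)"
      using k max_above_Suc_le[of j k n "u i" u] by simp
    then show ?thesis using sum_others_le
      by (simp add: raj_bar_split run_potential_split u'_simps max_above_u')
  qed
qed

end

section \<open>Structure of climbing chains\<close>

lemma apply_links_Cons: "apply_links w ((i, j) # C) = apply_links (w \<circ> transpose i j) C"
  by (simp add: apply_links_def)

lemma apply_links_untouched:
  "\<forall>(i, j)\<in>set C. a < i \<and> i < j \<Longrightarrow> apply_links w C a = w a"
  by (induction C arbitrary: w) (auto simp: apply_links_Cons apply_links_def)

lemma climbing_chain_ConsD: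
  assumes "climbing_chain n w ((i, j) # C)"
  shows "i \<in> {1..n}" "j \<in> {1..n}" "i < j" "bruhat_covers n w (w \<circ> transpose i j)"
    "climbing_chain n (w \<circ> transpose i j) C"
    "\<And>a. a < i \<Longrightarrow> w a = longest_perm n a" "\<And>c. c \<in> set C \<Longrightarrow> i \<le> fst c"
proof -
  have links: "\<forall>(k, l)\<in>set ((i, j) # C). k \<in> {1..n} \<and> l \<in> {1..n} \<and> k < l"
    and sorted: "sorted (map fst ((i, j) # C))"
    and final: "apply_links w ((i, j) # C) = longest_perm n"
    and covers: "\<And>p. p < length ((i, j) # C) \<Longrightarrow>
      bruhat_covers n (apply_links w (take p ((i, j) # C)))
        (apply_links w (take (Suc p) ((i, j) # C)))"
    using assms unfolding climbing_chain_def by blast+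
  show "i \<in> {1..n}" "j \<in> {1..n}" "i < j" using links by auto
  show "bruhat_covers n w (w \<circ> transpose i j)"
    using covers[of 0] by (simp add: apply_links_def)
  show "\<And>c. c \<in> set C \<Longrightarrow> i \<le> fst c" using sorted by auto
  have "bruhat_covers n (apply_links (w \<circ> transpose i j) (take p C))
      (apply_links (w \<circ> transpose i j) (take (Suc p) C))" if "p < length C" for p
    using covers[of "Suc p"] that by (simp add: apply_links_Cons)
  then show "climbing_chain n (w \<circ> transpose i j) C"
    using links sorted final by (auto simp: climbing_chain_def apply_links_Cons)
  fix a assume "a < i"
  then have "apply_links w ((i, j) # C) a = w a"
    using links sorted by (intro apply_links_untouched) fastforce
  then show "w a = longest_perm n a" by (simp add: final)
qed

text \<open>Further links at \<open>i\<close> other than \<open>(i, j)\<close> raise the value at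
  \<open>i\<close> and leave the one at \<open>j\<close> alone, so the descent persists and
  \<open>(i, j)\<close> cannot give a cover. Distinctness matters because markings form a set, in
  which a repeated link would count once.\<close>

lemma link_not_repeated:
  assumes "climbing_chain n w C" "w j < w i" "i < j" "\<forall>c\<in>set C. i \<le> fst c"
  shows "(i, j) \<notin> set C"
  using assms
proof (induction C arbitrary: w)
  case (Cons c C)
  obtain k l where c: "c = (k, l)" by (cases c)
  note chain = climbing_chain_ConsD[OF Cons.prems(1)[unfolded c]]
  have kl: "w k < w l" using cover_swap_less chain(1-4) by blast
  show ?case
  proof (cases "k = i")
    case True
    with kl Cons.prems have "l \<noteq> j" by auto
    have "(i, j) \<notin> set C"
      using Cons.prems chain(3) kl True \<open>l \<noteq> j\<close>
      by (intro Cons.IH[OF chain(5)]) auto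
    with \<open>l \<noteq> j\<close> c show ?thesis by auto
  next
    case False
    with Cons.prems c have "i < k" by force
    with chain(7) c show ?thesis by force
  qed
qed simp

lemma climbing_chain_head_notin:
  assumes "climbing_chain n w ((i, j) # C)"
  shows "(i, j) \<notin> set C"
proof -
  note chain = climbing_chain_ConsD[OF assms]
  have "w i < w j" using cover_swap_less chain(1-4) by blast
  then show ?thesis using chain(3,7) by (intro link_not_repeated[OF chain(5)]) auto
qed

lemma max_above_longest_perm:
  assumes "a \<in> {1..n}" "u permutes {1..n}" "\<And>b. b \<le> a \<Longrightarrow> u b = longest_perm n b"
  shows "max_above n u a (u a) = 0"
proof (rule max_above_cases[of n u a "u a"])
  fix k assume k: "a < k" "k \<le> n" "u a < u k"
  \<comment> \<open>The position where \<open>longest_perm n\<close> takes the value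
    \<open>u k\<close>; it turns out to lie left of \<open>a\<close>, contradicting
    injectivity.\<close>
  define b where "b = n + 1 - u k"
  have "u a = n + 1 - a" using assms(1) assms(3)[of a] by (simp add: longest_perm_def)
  moreover have "u k \<in> {1..n}" using permutes_in_image[OF assms(2), of k] k assms(1) by auto
  ultimately have "b < a" "1 \<le> b" "n + 1 - b = u k" using k assms(1) by (auto simp: b_def)
  then have "u b = u k" using assms(1) assms(3)[of b] by (simp add: longest_perm_def)
  then have "b = k" using permutes_inj[OF assms(2)] by (auto dest: injD)
  with k \<open>b < a\<close> show ?thesis by simp
qed

lemma climbing_chain_covering_link:
  assumes "climbing_chain n w ((i, j) # C)"
  shows "covering_link n i j w (w \<circ> transpose i j)"
proof
  note chain = climbing_chain_ConsD[OF assms]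
  show "i \<in> {1..n}" "j \<in> {1..n}" "i < j" "bruhat_covers n w (w \<circ> transpose i j)"
    by (fact chain)+
  then have "w permutes {1..n}" by (simp add: bruhat_covers_def)
  then show "max_above n w a (w a) = 0" if "a \<in> {1..n}" "a < i" for a
    using that chain(6) by (intro max_above_longest_perm) auto
qed (rule refl)

section \<open>Counting markings along a chain\<close>

lemma ex_nat_0_Suc: "(\<exists>p. P p) \<longleftrightarrow> P 0 \<or> (\<exists>p. P (Suc p))"
  by (metis not0_implies_Suc)

definition link_marked :: "nat \<times> nat \<Rightarrow> nat \<times> nat \<Rightarrow> bool" where
  "link_marked c d \<longleftrightarrow> fst c < fst d \<or> fst c = fst d \<and> snd c < snd d"

text \<open>The markings within \<open>C\<close> when \<open>c\<close> precedes it: the predecessor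
  of \<open>C ! p\<close> is \<open>(c # C) ! p\<close>, so index 0 needs no exception.\<close>

definition later_markings :: "nat \<times> nat \<Rightarrow> (nat \<times> nat) list \<Rightarrow> (nat \<times> nat) set" where
  "later_markings c C = {C ! p | p. p < length C \<and> link_marked ((c # C) ! p) (C ! p)}"

lemma later_markings_subset: "later_markings c C \<subseteq> set C"
  by (auto simp: later_markings_def)

lemma later_markings_Cons:
  "later_markings c (d # C) = (if link_marked c d then {d} else {}) \<union> later_markings d C"
proof -
  have "(\<exists>p. x = (d # C) ! p \<and> p < length (d # C) \<and> link_marked ((c # d # C) ! p) ((d # C) ! p))
    \<longleftrightarrow> x = d \<and> link_marked c d \<or> (\<exists>p. x = C ! p \<and> p < length C \<and> link_marked ((d # C) ! p) (C ! p))"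
    for x
    by (subst ex_nat_0_Suc) auto
  then show ?thesis by (auto simp: later_markings_def)
qed

lemma card_later_markings_Cons:
  assumes "d \<notin> set C"
  shows "card (later_markings c (d # C)) =
    (if link_marked c d then 1 else 0) + card (later_markings d C)"
proof -
  have "finite (later_markings d C)" "d \<notin> later_markings d C"
    using later_markings_subset[of d C] assms finite_subset by auto
  then show ?thesis by (simp add: later_markings_Cons)
qed

lemma minimal_markings_Cons: "minimal_markings (c # C) = insert c (later_markings c C)"
proof -
  have "(\<exists>p. x = (c # C) ! p \<and> p < length (c # C) \<and>
      (p = 0 \<or> link_marked ((c # C) ! (p - 1)) ((c # C) ! p)))
    \<longleftrightarrow> x = c \<or> (\<exists>p. x = C ! p \<and> p < length C \<and> link_marked ((c # C) ! p) (C ! p))" for x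
    by (subst ex_nat_0_Suc) auto
  then show ?thesis
    unfolding minimal_markings_def later_markings_def link_marked_def by auto
qed

lemma raj_bar_longest_perm:
  assumes "longest_perm n permutes {1..n}"
  shows "raj_bar n (longest_perm n) = 0"
  using assms by (simp add: raj_bar_eq_sum max_above_longest_perm)

text \<open>The two bounds feed each other. In the second, \<open>(i, j)\<close> stands for the link
  preceding \<open>C\<close>, and only markings after it are counted.\<close>

lemma climbing_chain_bounds:
  assumes "climbing_chain n u C" "u permutes {1..n}"
  shows "raj_bar n u \<le> (case C of [] \<Rightarrow> 0 | c # D \<Rightarrow> Suc (card (later_markings c D))) \<and>
    (\<forall>i j. i \<in> {1..n} \<longrightarrow> i \<le> j \<longrightarrow> (\<forall>c\<in>set C. i \<le> fst c) \<longrightarrow>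
      run_potential n u i j \<le> card (later_markings (i, j) C))"
  using assms
proof (induction C arbitrary: u)
  case Nil
  then have "u = longest_perm n" by (simp add: climbing_chain_def apply_links_def)
  with Nil have "raj_bar n u = 0" using raj_bar_longest_perm by simp
  then show ?case using run_potential_le_raj_bar[of _ n _ u] by fastforce
next
  case (Cons c C)
  obtain k l where c: "c = (k, l)" by (cases c)
  note chain = climbing_chain_ConsD[OF Cons.prems(1)[unfolded c]]
  interpret covering_link n k l u "u \<circ> transpose k l"
    by (rule climbing_chain_covering_link[OF Cons.prems(1)[unfolded c]])
  let ?u = "u \<circ> transpose k l"
  have perm: "?u permutes {1..n}" using cover by (simp add: bruhat_covers_def)
  have IH_raj: "raj_bar n ?u \<le> (case C of [] \<Rightarrow> 0 | c # D \<Rightarrow> Suc (card (later_markings c D)))"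
    and IH_run: "run_potential n ?u k l \<le> card (later_markings c C)"
    using Cons.IH[OF chain(5) perm] chain(1,7) less_imp_le[OF chain(3)] unfolding c by blast+
  \<comment> \<open>The induction hypothesis counts the head of \<open>C\<close> as marked; after
    \<open>c\<close> it may be unmarked, and the outer \<open>Suc\<close> makes up for that.\<close>
  have "raj_bar n ?u \<le> Suc (card (later_markings c C))"
  proof (cases C)
    case (Cons d D)
    with chain(5) have "d \<notin> set D" by (cases d) (auto dest: climbing_chain_head_notin)
    with IH_raj Cons show ?thesis by (simp add: card_later_markings_Cons)
  qed (use IH_raj in simp)
  with raj_bar_step IH_run have raj: "raj_bar n u \<le> Suc (card (later_markings c C))" by linarith
  have "run_potential n u i j \<le> card (later_markings (i, j) (c # C))"
    if ij: "i \<in> {1..n}" "i \<le> j" and le: "\<forall>d\<in>set (c # C). i \<le> fst d" for i j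
  proof -
    have notin: "c \<notin> set C" using Cons.prems(1) c climbing_chain_head_notin by auto
    show ?thesis
    proof (cases "link_marked (i, j) c")
      \<comment> \<open>The new marking pays for passing from $T_{ij}(u)$ to the larger
        $S(u)$.\<close>
      case True
      then show ?thesis using raj run_potential_le_raj_bar[OF ij, of u] notin
        by (simp add: card_later_markings_Cons)
    next
      case False
      \<comment> \<open>An unmarked link continues the run, so the potential does not exceed its
        value after the link.\<close>
      with le c have "i = k" "l \<le> j" by (auto simp: link_marked_def)
      then show ?thesis using False run_potential_step[of j] IH_run notin
        by (simp add: card_later_markings_Cons)
    qed
  qed
  with raj show ?case by simp
qed

theorem theorem7p9:
  fixes n :: nat and w :: "nat \<Rightarrow> nat" and C :: "(nat \<times> nat) list"
  assumes "w permutes {1..n}"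
    and "climbing_chain n w C"
  shows "raj_bar n w \<le> card (minimal_markings C)"
proof (cases C)
  case Nil
  then show ?thesis using climbing_chain_bounds[OF assms(2,1)] by simp
next
  case (Cons c D)
  \<comment> \<open>As \<open>c\<close> does not recur, it adds exactly one to the later markings,
    matching the \<open>Suc\<close> of the bound.\<close>
  then have "c \<notin> set D" using assms(2) by (cases c) (auto dest: climbing_chain_head_notin)
  then have "finite (later_markings c D)" "c \<notin> later_markings c D"
    using later_markings_subset[of c D] finite_subset by auto
  then show ?thesis using Cons climbing_chain_bounds[OF assms(2,1)]
    by (simp add: minimal_markings_Cons)
qed

end
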